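(* The absolute value function $|\cdot|$ on dual numbers maps $\mathbb{D}$ into $\mathbb{D}_+$. Moreover, for all $p, q \in \mathbb{D}$: 1. $|q| = 0$ if and only if $q = 0$; 2. $|q| = q$ if $q \ge 0$, and $|q| > q$ otherwise; 3. $|q| = \sqrt{q^2}$ if $q$ is appreciable; 4. $|pq| = |p|\,|q|$; 5. $|p+q| \le |p| + |q|$.
   Context: A dual number is $q = q_{st} + q_{\mathcal{I}}\epsilon$ with $q_{st}, q_{\mathcal{I}} \in \mathbb{R}$ (standard part and infinitesimal part), where $\epsilon$ satisfies $\epsilon^2 = 0$; $\mathbb{D}$ denotes the commutative real algebra of dual numbers, with $p+q = (p_{st}+q_{st}) + (p_{\mathcal{I}}+q_{\mathcal{I}})\epsilon$ and $pq = p_{st}q_{st} + (p_{st}q_{\mathcal{I}} + p_{\mathcal{I}}q_{st})\epsilon$. A dual number $q$ is appreciable if $q_{st} \neq 0$, and infinitesimal otherwise. Total order on $\mathbb{D}$: $q < p$ if $q_{st} < p_{st}$, or $q_{st} = p_{st}$ and $q_{\mathcal{I}} < p_{\mathcal{I}}$; $q \le p$ means $q<p$ or $q=p$. $\mathbb{D}_+ = \{q \in \mathbb{D} : q \ge 0\}$. Square root: if $q \in \mathbb{D}$ is positive and appreciable (i.e. $q_{st} > 0$), then $\sqrt{q} = \sqrt{q_{st}} + \frac{q_{\mathcal{I}}}{2\sqrt{q_{st}}}\epsilon$; also $\sqrt{0} = 0$. Absolute value: for $q \in \mathbb{D}$, $|q| = |q_{st}| + \mathrm{sgn}(q_{st})q_{\mathcal{I}}\epsilon$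 if $q_{st} \neq 0$, and $|q| = |q_{\mathcal{I}}|\epsilon$ if $q_{st} = 0$, where for real $u$, $\mathrm{sgn}(u) = 1, 0, -1$ according as $u>0$, $u=0$, $u<0$, and $|u|$ is the usual real absolute value. *)

theory Defs
  imports "HOL-Analysis.Analysis"
begin

text \<open>
  Dual numbers with their algebra structure over the reals, the lexicographic order, absolute value
  and square root.  The term \<open>Dual a b\<close> stands for \<open>a + b \<epsilon>\<close>, cf. lemma \<open>dual_decompose\<close> below.
\<close>

datatype dual = Dual (st_part: real) (inf_part: real)

lemma dual_eq_iff: "p = q \<longleftrightarrow> st_part p = st_part q \<and> inf_part p = inf_part q"
  by (cases p; cases q) simp

instantiation dual :: "{comm_ring_1, real_algebra_1}"
begin

definition zero_dual :: dual where
  "0 = Dual 0 0"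

definition one_dual :: dual where
  "1 = Dual 1 0"

definition plus_dual :: "dual \<Rightarrow> dual \<Rightarrow> dual" where
  "p + q = Dual (st_part p + st_part q) (inf_part p + inf_part q)"

definition uminus_dual :: "dual \<Rightarrow> dual" where
  "- q = Dual (- st_part q) (- inf_part q)"

definition minus_dual :: "dual \<Rightarrow> dual \<Rightarrow> dual" where
  "p - q = Dual (st_part p - st_part q) (inf_part p - inf_part q)"

definition times_dual :: "dual \<Rightarrow> dual \<Rightarrow> dual" where
  "p * q = Dual (st_part p * st_part q) (st_part p * inf_part q + inf_part p * st_part q)"

definition scaleR_dual :: "real \<Rightarrow> dual \<Rightarrow> dual" where
  "scaleR r q = Dual (r * st_part q) (r * inf_part q)"

instance
  by standard
    (simp_all add: zero_dual_def one_dual_def plus_dual_def uminus_dual_def minus_dual_def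
      times_dual_def scaleR_dual_def dual_eq_iff algebra_simps)

end

definition dual_eps :: dual ("\<epsilon>") where
  "\<epsilon> = Dual 0 1"

lemma dual_eps_square: "\<epsilon>\<^sup>2 = 0"
  by (simp add: power2_eq_square dual_eps_def times_dual_def zero_dual_def)

lemma dual_decompose: "q = of_real (st_part q) + of_real (inf_part q) * \<epsilon>"
  by (simp add: of_real_def one_dual_def plus_dual_def times_dual_def scaleR_dual_def
      dual_eps_def dual_eq_iff)

instantiation dual :: linorder
begin

definition less_dual :: "dual \<Rightarrow> dual \<Rightarrow> bool" where
  "q < p \<longleftrightarrow> st_part q < st_part p \<or> st_part q = st_part p \<and> inf_part q < inf_part p"

definition less_eq_dual :: "dual \<Rightarrow> dual \<Rightarrow> bool" where
  "q \<le> p \<longleftrightarrow> q < p \<or> q = (p :: dual)"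

instance
  by standard (auto simp: less_dual_def less_eq_dual_def dual_eq_iff)

end

definition dual_nonneg :: "dual set" ("\<D>\<^sub>+") where
  "\<D>\<^sub>+ = {q. 0 \<le> q}"

definition appreciable :: "dual \<Rightarrow> bool" where
  "appreciable q \<longleftrightarrow> st_part q \<noteq> 0"

text \<open>
  The square root is a partial operation: it is left unspecified on negative dual numbers and on
  nonzero infinitesimals.
\<close>

definition dual_sqrt :: "dual \<Rightarrow> dual" where
  "dual_sqrt q =
     (if 0 < q \<and> appreciable q
      then Dual (sqrt (st_part q)) (inf_part q / (2 * sqrt (st_part q)))
      else if q = 0 then 0
      else undefined)"

lemma pos_appreciable_iff: "0 < q \<and> appreciable q \<longleftrightarrow> 0 < st_part q"
  by (auto simp: less_dual_def zero_dual_def appreciable_def)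

instantiation dual :: abs
begin

definition abs_dual :: "dual \<Rightarrow> dual" where
  "\<bar>q\<bar> =
     (if st_part q \<noteq> 0 then Dual \<bar>st_part q\<bar> (sgn (st_part q) * inf_part q)
      else Dual 0 \<bar>inf_part q\<bar>)"

instance ..

end

end

theory Submission
  imports Defs
begin

text \<open>
  The dual numbers with the lexicographic order are a linearly ordered commutative ring:
  addition acts componentwise, so it preserves the lexicographic order, and the product of two
  nonnegative dual numbers is nonnegative.  In these terms the absolute value
  is the order-theoretic one, \<open>\<bar>q\<bar> = max q (- q)\<close>: the factor \<open>sgn (st_part q)\<close>
  flips both components of \<open>q\<close> together, and for an infinitesimal \<open>q\<close> the sign of \<open>q\<close>
  is that of its infinitesimal part.  Nonnegativity, definiteness, the comparison with \<open>q\<close> and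
  the triangle inequality are then facts about any linearly ordered abelian group, and
  multiplicativity follows from the rule of signs.  Positive infinitesimals have square zero, so
  the ring is not an integral domain and products of positive elements need not be positive; weak
  monotonicity of multiplication still suffices for the rule of signs.

  The square root formula needs the components.  For appreciable \<open>q = a + b \<epsilon>\<close> one has
  \<open>q\<^sup>2 = a\<^sup>2 + 2 a b \<epsilon>\<close>, hence \<open>sqrt (a\<^sup>2) = \<bar>a\<bar>\<close> and
  \<open>2 a b / (2 \<bar>a\<bar>) = sgn a * b\<close>.
\<close>

lemma less_eq_dual_iff:
  "p \<le> q \<longleftrightarrow> st_part p < st_part q \<or> st_part p = st_part q \<and> inf_part p \<le> inf_part q"
  by (auto simp: less_eq_dual_def less_dual_def dual_eq_iff)

text \<open>
  If both standard parts are positive, so is that of the product.  If, say, \<open>p\<close> is infinitesimal,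
  the product is the infinitesimal \<open>inf_part p * st_part q * \<epsilon>\<close>, whose factors are nonnegative.
\<close>

lemma dual_mult_nonneg:
  fixes p q :: dual
  assumes "0 \<le> p" and "0 \<le> q"
  shows "0 \<le> p * q"
  using assms by (auto simp: less_eq_dual_iff zero_dual_def times_dual_def)

lemma dual_abs_if: "\<bar>q\<bar> = (if q < 0 then - q else q)" for q :: dual
  by (auto simp: abs_dual_def less_dual_def zero_dual_def uminus_dual_def dual_eq_iff)

instance dual :: linordered_ring
proof
  fix p q r :: dual
  show "p \<le> q \<Longrightarrow> r + p \<le> r + q"
    by (auto simp: less_eq_dual_iff plus_dual_def)
  show "\<bar>p\<bar> = (if p < 0 then - p else p)"
    by (rule dual_abs_if)
  have le_iff: "x \<le> y \<longleftrightarrow> 0 \<le> y - x" for x y :: dual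
    by (auto simp: less_eq_dual_iff zero_dual_def minus_dual_def)
  show "r * p \<le> r * q" if "p \<le> q" "0 \<le> r"
    using that dual_mult_nonneg[of r "q - p"]
    by (simp add: le_iff[of p q] le_iff[of "r * p"] right_diff_distrib)
  show "p * r \<le> q * r" if "p \<le> q" "0 \<le> r"
    using that dual_mult_nonneg[of "q - p" r]
    by (simp add: le_iff[of p q] le_iff[of "p * r"] left_diff_distrib)
qed

text \<open>
  The rule of signs in any linearly ordered ring: weak monotonicity determines the sign of the
  product up to zero, so zero divisors do no harm.
\<close>

lemma abs_mult_linordered_ring:
  fixes a b :: "'a :: linordered_ring"
  shows "\<bar>a * b\<bar> = \<bar>a\<bar> * \<bar>b\<bar>"
proof (cases "0 \<le> a"; cases "0 \<le> b")
  assume "0 \<le> a" "0 \<le> b"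
  then show ?thesis
    by (simp only: abs_of_nonneg mult_nonneg_nonneg)
next
  assume "0 \<le> a" "\<not> 0 \<le> b"
  then have "b \<le> 0" "a * b \<le> 0"
    by (simp_all add: mult_nonneg_nonpos)
  with \<open>0 \<le> a\<close> show ?thesis
    by (simp only: abs_of_nonneg abs_of_nonpos mult_minus_right)
next
  assume "\<not> 0 \<le> a" "0 \<le> b"
  then have "a \<le> 0" "a * b \<le> 0"
    by (simp_all add: mult_nonpos_nonneg)
  with \<open>0 \<le> b\<close> show ?thesis
    by (simp only: abs_of_nonneg abs_of_nonpos mult_minus_left)
next
  assume "\<not> 0 \<le> a" "\<not> 0 \<le> b"
  then have "a \<le> 0" "b \<le> 0" "0 \<le> a * b"
    by (simp_all add: mult_nonpos_nonpos)
  then show ?thesis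
    by (simp only: abs_of_nonneg abs_of_nonpos minus_mult_minus)
qed

lemma dual_square: "q\<^sup>2 = Dual ((st_part q)\<^sup>2) (2 * st_part q * inf_part q)"
  by (simp add: power2_eq_square times_dual_def)

lemma dual_abs_eq_sqrt_square:
  assumes "appreciable q"
  shows "\<bar>q\<bar> = dual_sqrt (q\<^sup>2)"
proof -
  have "st_part q \<noteq> 0"
    using assms by (simp add: appreciable_def)
  moreover from this have "0 < q\<^sup>2 \<and> appreciable (q\<^sup>2)"
    by (simp add: pos_appreciable_iff dual_square)
  ultimately show ?thesis
    by (simp add: dual_sqrt_def abs_dual_def dual_square sgn_real_def abs_if)
qed

theorem theorem3p1:
  shows "(abs :: dual \<Rightarrow> dual) \<in> UNIV \<rightarrow> \<D>\<^sub>+ \<and>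
    (\<forall>p q :: dual.
      (\<bar>q\<bar> = 0 \<longleftrightarrow> q = 0) \<and>
      (if 0 \<le> q then \<bar>q\<bar> = q else \<bar>q\<bar> > q) \<and>
      (appreciable q \<longrightarrow> \<bar>q\<bar> = dual_sqrt (q\<^sup>2)) \<and>
      \<bar>p * q\<bar> = \<bar>p\<bar> * \<bar>q\<bar> \<and>
      \<bar>p + q\<bar> \<le> \<bar>p\<bar> + \<bar>q\<bar>)"
proof (intro conjI allI impI)
  show "(abs :: dual \<Rightarrow> dual) \<in> UNIV \<rightarrow> \<D>\<^sub>+"
    by (simp add: dual_nonneg_def)
next
  fix p q :: dual
  show "\<bar>q\<bar> = 0 \<longleftrightarrow> q = 0"
    by (rule abs_eq_0)
  have "q < \<bar>q\<bar>" if "\<not> 0 \<le> q"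
    using that by (intro less_le_trans[of q 0 "\<bar>q\<bar>"]) simp_all
  then show "if 0 \<le> q then \<bar>q\<bar> = q else \<bar>q\<bar> > q"
    by simp
  show "\<bar>q\<bar> = dual_sqrt (q\<^sup>2)" if "appreciable q"
    using that by (rule dual_abs_eq_sqrt_square)
  show "\<bar>p * q\<bar> = \<bar>p\<bar> * \<bar>q\<bar>"
    by (rule abs_mult_linordered_ring)
  show "\<bar>p + q\<bar> \<le> \<bar>p\<bar> + \<bar>q\<bar>"
    by (rule abs_triangle_ineq)
qed

end
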